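(* Let $D:\mathcal{J}\to\mathcal{C}$ be a functor such that the limit $\lim_{J\in\mathcal{J}}DJ\in\mathcal{C}$ exists and the pointwise colimit functor $\operatorname{colim}_{J\in\mathcal{J}^{\mathrm{op}}}\mathrm{Hom}_{\mathcal{C}}(DJ,-):\mathcal{C}\to\mathrm{Set}$ exists. Let $$\mathrm{can}_D:\operatorname{colim}_{J\in\mathcal{J}^{\mathrm{op}}}\mathrm{Hom}_{\mathcal{C}}(DJ,-)\to\mathrm{Hom}_{\mathcal{C}}\Big(\lim_{J\in\mathcal{J}}DJ,-\Big)$$ be the canonical morphism. For a functor $F:\mathcal{C}\to\mathrm{Set}$, the following are equivalent: (a) $F$ preserves the limit $\lim_{J\in\mathcal{J}}DJ$. (b) For any morphism $u:\operatorname{colim}_{J\in\mathcal{J}^{\mathrm{op}}}\mathrm{Hom}_{\mathcal{C}}(DJ,-)\to F$ there is a unique morphism $v:\mathrm{Hom}_{\mathcal{C}}(\lim_{J\in\mathcal{J}}DJ,-)\to F$ such that $v\cdot\mathrm{can}_D=u$. Moreover, in the situation of (b), with $u$ and $v$ as there: (i) if $u$ is an epimorphism then $v$ is an epimorphism; (ii) if $u$ is a split monomorphism then $v$ is a split monomorphism; (iii) if $u$ is an isomorphism then $v$ is an isomorphism.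
   Context: The categories $\mathcal{J}$ and $\mathcal{C}$ are not required to be small. The colimit functor $\operatorname{colim}_{J\in\mathcal{J}^{\mathrm{op}}}\mathrm{Hom}_{\mathcal{C}}(DJ,-)$ is computed pointwise: its value at $C\in\mathcal{C}$ is the colimit (in $\mathrm{Set}$) of $J\mapsto\mathrm{Hom}_{\mathcal{C}}(DJ,C)$, and it "exists" if this colimit exists for each $C$. The canonical morphism $\mathrm{can}_D$ is the one induced, via the universal property of the colimit and the Yoneda lemma, by the limit projections $\lim_{J'\in\mathcal{J}}DJ'\to DJ$: its restriction to the $J$-component is precomposition with the projection to $DJ$. Morphisms between functors are natural transformations. *)

theory Defs
  imports "HOL-Library.FuncSet"
begin

section \<open>Categories and functors\<close>

text \<open>
  Categories are given by indexed families of hom-sets, which need not be disjoint; consequently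
  composition and the arrow part of a functor take the objects involved as arguments:
  \<open>Comp C X Y Z g f\<close> is \<open>g\<close> after \<open>f\<close> for \<open>f : X \<rightarrow> Y\<close> and \<open>g : Y \<rightarrow> Z\<close>.
  No smallness condition is imposed on the collections of objects and of arrows.
\<close>

record ('o, 'm) cat =
  Obj :: "'o set"
  Hom :: "'o \<Rightarrow> 'o \<Rightarrow> 'm set"
  Ident :: "'o \<Rightarrow> 'm"
  Comp :: "'o \<Rightarrow> 'o \<Rightarrow> 'o \<Rightarrow> 'm \<Rightarrow> 'm \<Rightarrow> 'm"

definition category :: "('o, 'm) cat \<Rightarrow> bool" where
  "category C \<longleftrightarrow>
     (\<forall>X\<in>Obj C. Ident C X \<in> Hom C X X) \<and>
     (\<forall>X\<in>Obj C. \<forall>Y\<in>Obj C. \<forall>Z\<in>Obj C. \<forall>f\<in>Hom C X Y. \<forall>g\<in>Hom C Y Z.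
        Comp C X Y Z g f \<in> Hom C X Z) \<and>
     (\<forall>X\<in>Obj C. \<forall>Y\<in>Obj C. \<forall>f\<in>Hom C X Y.
        Comp C X X Y f (Ident C X) = f \<and> Comp C X Y Y (Ident C Y) f = f) \<and>
     (\<forall>W\<in>Obj C. \<forall>X\<in>Obj C. \<forall>Y\<in>Obj C. \<forall>Z\<in>Obj C.
        \<forall>f\<in>Hom C W X. \<forall>g\<in>Hom C X Y. \<forall>h\<in>Hom C Y Z.
        Comp C W Y Z h (Comp C W X Y g f) = Comp C W X Z (Comp C X Y Z h g) f)"

record ('o1, 'm1, 'o2, 'm2) func =
  FObj :: "'o1 \<Rightarrow> 'o2"
  FMap :: "'o1 \<Rightarrow> 'o1 \<Rightarrow> 'm1 \<Rightarrow> 'm2"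

definition is_functor ::
    "('o1, 'm1) cat \<Rightarrow> ('o2, 'm2) cat \<Rightarrow> ('o1, 'm1, 'o2, 'm2) func \<Rightarrow> bool" where
  "is_functor A B F \<longleftrightarrow>
     (\<forall>X\<in>Obj A. FObj F X \<in> Obj B) \<and>
     (\<forall>X\<in>Obj A. \<forall>Y\<in>Obj A. \<forall>f\<in>Hom A X Y.
        FMap F X Y f \<in> Hom B (FObj F X) (FObj F Y)) \<and>
     (\<forall>X\<in>Obj A. FMap F X X (Ident A X) = Ident B (FObj F X)) \<and>
     (\<forall>X\<in>Obj A. \<forall>Y\<in>Obj A. \<forall>Z\<in>Obj A. \<forall>f\<in>Hom A X Y. \<forall>g\<in>Hom A Y Z.
        FMap F X Z (Comp A X Y Z g f) =
        Comp B (FObj F X) (FObj F Y) (FObj F Z) (FMap F Y Z g) (FMap F X Y f))"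

definition func_comp ::
    "('o2, 'm2, 'o3, 'm3) func \<Rightarrow> ('o1, 'm1, 'o2, 'm2) func \<Rightarrow> ('o1, 'm1, 'o3, 'm3) func" where
  "func_comp G F =
     \<lparr> FObj = (\<lambda>X. FObj G (FObj F X)),
       FMap = (\<lambda>X Y f. FMap G (FObj F X) (FObj F Y) (FMap F X Y f)) \<rparr>"

definition op_cat :: "('o, 'm) cat \<Rightarrow> ('o, 'm) cat" where
  "op_cat C =
     \<lparr> Obj = Obj C,
       Hom = (\<lambda>X Y. Hom C Y X),
       Ident = Ident C,
       Comp = (\<lambda>X Y Z g f. Comp C Z Y X f g) \<rparr>"

definition op_func :: "('o1, 'm1, 'o2, 'm2) func \<Rightarrow> ('o1, 'm1, 'o2, 'm2) func" where
  "op_func F = \<lparr> FObj = FObj F, FMap = (\<lambda>X Y f. FMap F Y X f) \<rparr>"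

definition epimorphism :: "('o, 'm) cat \<Rightarrow> 'o \<Rightarrow> 'o \<Rightarrow> 'm \<Rightarrow> bool" where
  "epimorphism C X Y e \<longleftrightarrow> e \<in> Hom C X Y \<and>
     (\<forall>Z\<in>Obj C. \<forall>g\<in>Hom C Y Z. \<forall>h\<in>Hom C Y Z.
        Comp C X Y Z g e = Comp C X Y Z h e \<longrightarrow> g = h)"

definition split_monomorphism :: "('o, 'm) cat \<Rightarrow> 'o \<Rightarrow> 'o \<Rightarrow> 'm \<Rightarrow> bool" where
  "split_monomorphism C X Y m \<longleftrightarrow> m \<in> Hom C X Y \<and>
     (\<exists>r\<in>Hom C Y X. Comp C X Y X r m = Ident C X)"

definition isomorphism :: "('o, 'm) cat \<Rightarrow> 'o \<Rightarrow> 'o \<Rightarrow> 'm \<Rightarrow> bool" where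
  "isomorphism C X Y i \<longleftrightarrow> i \<in> Hom C X Y \<and>
     (\<exists>j\<in>Hom C Y X. Comp C X Y X j i = Ident C X \<and> Comp C Y X Y i j = Ident C Y)"

section \<open>Limits and colimits\<close>

definition is_cone ::
    "('j, 'k) cat \<Rightarrow> ('o, 'm) cat \<Rightarrow> ('j, 'k, 'o, 'm) func \<Rightarrow> 'o \<Rightarrow> ('j \<Rightarrow> 'm) \<Rightarrow> bool" where
  "is_cone J C D X q \<longleftrightarrow> X \<in> Obj C \<and>
     (\<forall>j\<in>Obj J. q j \<in> Hom C X (FObj D j)) \<and>
     (\<forall>i\<in>Obj J. \<forall>j\<in>Obj J. \<forall>a\<in>Hom J i j.
        Comp C X (FObj D i) (FObj D j) (FMap D i j a) (q i) = q j)"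

definition is_limit ::
    "('j, 'k) cat \<Rightarrow> ('o, 'm) cat \<Rightarrow> ('j, 'k, 'o, 'm) func \<Rightarrow> 'o \<Rightarrow> ('j \<Rightarrow> 'm) \<Rightarrow> bool" where
  "is_limit J C D L p \<longleftrightarrow> is_cone J C D L p \<and>
     (\<forall>X q. is_cone J C D X q \<longrightarrow>
        (\<exists>!h. h \<in> Hom C X L \<and> (\<forall>j\<in>Obj J. Comp C X L (FObj D j) (p j) h = q j)))"

definition is_cocone ::
    "('j, 'k) cat \<Rightarrow> ('o, 'm) cat \<Rightarrow> ('j, 'k, 'o, 'm) func \<Rightarrow> 'o \<Rightarrow> ('j \<Rightarrow> 'm) \<Rightarrow> bool" where
  "is_cocone J C D X q \<longleftrightarrow> X \<in> Obj C \<and>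
     (\<forall>j\<in>Obj J. q j \<in> Hom C (FObj D j) X) \<and>
     (\<forall>i\<in>Obj J. \<forall>j\<in>Obj J. \<forall>a\<in>Hom J i j.
        Comp C (FObj D i) (FObj D j) X (q j) (FMap D i j a) = q i)"

definition is_colimit ::
    "('j, 'k) cat \<Rightarrow> ('o, 'm) cat \<Rightarrow> ('j, 'k, 'o, 'm) func \<Rightarrow> 'o \<Rightarrow> ('j \<Rightarrow> 'm) \<Rightarrow> bool" where
  "is_colimit J C D K k \<longleftrightarrow> is_cocone J C D K k \<and>
     (\<forall>X q. is_cocone J C D X q \<longrightarrow>
        (\<exists>!h. h \<in> Hom C K X \<and> (\<forall>j\<in>Obj J. Comp C (FObj D j) K X h (k j) = q j)))"

text \<open>\<open>F\<close> preserves the given limit \<open>(L, p)\<close> of \<open>D\<close>: the image cone is a limit of \<open>F \<circ> D\<close>.\<close>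

definition preserves_limit ::
    "('j, 'k) cat \<Rightarrow> ('o2, 'm2) cat \<Rightarrow> ('j, 'k, 'o, 'm) func \<Rightarrow> 'o \<Rightarrow> ('j \<Rightarrow> 'm) \<Rightarrow>
     ('o, 'm, 'o2, 'm2) func \<Rightarrow> bool" where
  "preserves_limit J S D L p F \<longleftrightarrow>
     is_limit J S (func_comp F D) (FObj F L) (\<lambda>j. FMap F L (FObj D j) (p j))"

section \<open>The category of sets\<close>

text \<open>
  The small sets are the members of a collection \<open>U\<close> of subsets of a type \<open>'u\<close>, closed under the
  usual operations.  Closure under power sets is not demanded, so the theory applies both to
  Grothendieck universes (\<open>'u\<close> the elements of the universe, \<open>U\<close> the small subsets) and to the
  collection of all subsets of an arbitrary infinite type.
\<close>

definition set_universe :: "'u set set \<Rightarrow> bool" where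
  "set_universe U \<longleftrightarrow>
     (\<exists>A\<in>U. infinite A) \<and>
     (\<forall>A\<in>U. \<forall>B. B \<subseteq> A \<longrightarrow> B \<in> U) \<and>
     (\<forall>A\<in>U. \<forall>f. f ` A \<in> U) \<and>
     (\<forall>A\<in>U. \<forall>B. (\<forall>a\<in>A. B a \<in> U) \<longrightarrow> (\<Union>a\<in>A. B a) \<in> U)"

definition set_cat :: "'u set set \<Rightarrow> ('u set, 'u \<Rightarrow> 'u) cat" where
  "set_cat U =
     \<lparr> Obj = U,
       Hom = (\<lambda>A B. A \<rightarrow>\<^sub>E B),
       Ident = (\<lambda>A. \<lambda>x\<in>A. x),
       Comp = (\<lambda>A B C g f. compose A g f) \<rparr>"

text \<open>
  The hom-sets themselves are required to be objects of the category of sets.  Since hom-sets need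
  not be disjoint, this bounds neither the objects nor the totality of arrows.
\<close>

definition locally_small :: "'u set set \<Rightarrow> ('o, 'u) cat \<Rightarrow> bool" where
  "locally_small U C \<longleftrightarrow> (\<forall>X\<in>Obj C. \<forall>Y\<in>Obj C. Hom C X Y \<in> U)"

text \<open>The representable functors \<open>Hom(A, -) : C \<rightarrow> Set\<close> and \<open>Hom(-, B) : C\<^sup>o\<^sup>p \<rightarrow> Set\<close>.\<close>

definition hom_func :: "('o, 'u) cat \<Rightarrow> 'o \<Rightarrow> ('o, 'u, 'u set, 'u \<Rightarrow> 'u) func" where
  "hom_func C A =
     \<lparr> FObj = (\<lambda>X. Hom C A X),
       FMap = (\<lambda>X Y f. \<lambda>g\<in>Hom C A X. Comp C A X Y f g) \<rparr>"

definition contra_hom_func :: "('o, 'u) cat \<Rightarrow> 'o \<Rightarrow> ('o, 'u, 'u set, 'u \<Rightarrow> 'u) func" where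
  "contra_hom_func C B =
     \<lparr> FObj = (\<lambda>X. Hom C X B),
       FMap = (\<lambda>X Y f. \<lambda>g\<in>Hom C X B. Comp C Y X B g f) \<rparr>"

section \<open>Functor categories\<close>

text \<open>
  Natural transformations are families that are \<^const>\<open>undefined\<close> outside the objects of the
  source category, so that two of them are equal as soon as their components are.
\<close>

definition nat_trans ::
    "('o1, 'm1) cat \<Rightarrow> ('o2, 'm2) cat \<Rightarrow> ('o1, 'm1, 'o2, 'm2) func \<Rightarrow>
     ('o1, 'm1, 'o2, 'm2) func \<Rightarrow> ('o1 \<Rightarrow> 'm2) set" where
  "nat_trans A B F G =
     {t \<in> (\<Pi>\<^sub>E X\<in>Obj A. Hom B (FObj F X) (FObj G X)).
        \<forall>X\<in>Obj A. \<forall>Y\<in>Obj A. \<forall>f\<in>Hom A X Y.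
          Comp B (FObj F X) (FObj F Y) (FObj G Y) (t Y) (FMap F X Y f) =
          Comp B (FObj F X) (FObj G X) (FObj G Y) (FMap G X Y f) (t X)}"

definition functor_cat ::
    "('o1, 'm1) cat \<Rightarrow> ('o2, 'm2) cat \<Rightarrow> (('o1, 'm1, 'o2, 'm2) func, 'o1 \<Rightarrow> 'm2) cat" where
  "functor_cat A B =
     \<lparr> Obj = {F. is_functor A B F},
       Hom = nat_trans A B,
       Ident = (\<lambda>F. \<lambda>X\<in>Obj A. Ident B (FObj F X)),
       Comp = (\<lambda>F G H t s. \<lambda>X\<in>Obj A. Comp B (FObj F X) (FObj G X) (FObj H X) (t X) (s X)) \<rparr>"

section \<open>The pointwise colimit of representables and the canonical morphism\<close>

text \<open>The diagram \<open>j \<mapsto> Hom(D j, X)\<close> on the opposite of the shape of \<open>D\<close>.\<close>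

definition hom_diagram ::
    "('o, 'u) cat \<Rightarrow> ('j, 'k, 'o, 'u) func \<Rightarrow> 'o \<Rightarrow> ('j, 'k, 'u set, 'u \<Rightarrow> 'u) func" where
  "hom_diagram C D X = func_comp (contra_hom_func C X) (op_func D)"

definition pointwise_colimits ::
    "'u set set \<Rightarrow> ('j, 'k) cat \<Rightarrow> ('o, 'u) cat \<Rightarrow> ('j, 'k, 'o, 'u) func \<Rightarrow>
     ('o \<Rightarrow> 'u set) \<Rightarrow> ('o \<Rightarrow> 'j \<Rightarrow> 'u \<Rightarrow> 'u) \<Rightarrow> bool" where
  "pointwise_colimits U J C D K k \<longleftrightarrow>
     (\<forall>X\<in>Obj C. is_colimit (op_cat J) (set_cat U) (hom_diagram C D X) (K X) (k X))"

text \<open>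
  The functor \<open>colim Hom(D j, -)\<close> determined by chosen colimits \<open>(K X, k X)\<close>: an arrow
  \<open>f : X \<rightarrow> Y\<close> is sent to the map induced by postcomposition with \<open>f\<close> on each \<open>Hom(D j, X)\<close>.
\<close>

definition colim_hom_func ::
    "'u set set \<Rightarrow> ('j, 'k) cat \<Rightarrow> ('o, 'u) cat \<Rightarrow> ('j, 'k, 'o, 'u) func \<Rightarrow>
     ('o \<Rightarrow> 'u set) \<Rightarrow> ('o \<Rightarrow> 'j \<Rightarrow> 'u \<Rightarrow> 'u) \<Rightarrow> ('o, 'u, 'u set, 'u \<Rightarrow> 'u) func" where
  "colim_hom_func U J C D K k =
     \<lparr> FObj = K,
       FMap = (\<lambda>X Y f. THE h. h \<in> Hom (set_cat U) (K X) (K Y) \<and>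
         (\<forall>j\<in>Obj J.
            Comp (set_cat U) (Hom C (FObj D j) X) (K X) (K Y) h (k X j) =
            Comp (set_cat U) (Hom C (FObj D j) X) (Hom C (FObj D j) Y) (K Y)
              (k Y j) (FMap (hom_func C (FObj D j)) X Y f))) \<rparr>"

text \<open>
  The component at \<open>X\<close> of the canonical morphism \<open>colim Hom(D j, -) \<rightarrow> Hom(L, -)\<close> is the map induced
  by the cocone of precompositions with the projections \<open>p j : L \<rightarrow> D j\<close>.
\<close>

definition can ::
    "'u set set \<Rightarrow> ('j, 'k) cat \<Rightarrow> ('o, 'u) cat \<Rightarrow> ('j, 'k, 'o, 'u) func \<Rightarrow>
     ('o \<Rightarrow> 'u set) \<Rightarrow> ('o \<Rightarrow> 'j \<Rightarrow> 'u \<Rightarrow> 'u) \<Rightarrow> 'o \<Rightarrow> ('j \<Rightarrow> 'u) \<Rightarrow> 'o \<Rightarrow> 'u \<Rightarrow> 'u" where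
  "can U J C D K k L p =
     (\<lambda>X\<in>Obj C. THE h. h \<in> Hom (set_cat U) (K X) (Hom C L X) \<and>
       (\<forall>j\<in>Obj J.
          Comp (set_cat U) (Hom C (FObj D j) X) (K X) (Hom C L X) h (k X j) =
          FMap (contra_hom_func C X) (FObj D j) L (p j)))"

end

theory Submission
  imports Defs
begin

text \<open>
  Both conditions say that one map between two collections is a bijection.  By the Yoneda lemma, a
  natural transformation \<open>v : Hom(L, -) \<rightarrow> F\<close> is the same as the element \<open>v(id)\<close> of \<open>F L\<close>.  A natural
  transformation \<open>u : colim Hom(D j, -) \<rightarrow> F\<close> is a compatible family of natural transformations
  \<open>Hom(D j, -) \<rightarrow> F\<close>, so by Yoneda again it is the same as a matching family: elements
  \<open>x j \<in> F (D j)\<close> with \<open>F (D a) (x i) = x j\<close> for every \<open>a : i \<rightarrow> j\<close>.  This is the content of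
  \<open>family_of_matching\<close>, \<open>family_of_surj\<close> and \<open>nat_trans_colim_eqI\<close>.  Under these identifications
  precomposition with the canonical morphism becomes \<open>a \<mapsto> (F (p j) a)\<^sub>j\<close> (\<open>comp_can_eq_iff\<close>), so
  condition (b) says that every matching family is \<open>(F (p j) a)\<^sub>j\<close> for a unique \<open>a \<in> F L\<close>.  That is
  exactly how a limit cone of sets is recognised on elements (\<open>is_limit_set_iff\<close>), hence it is
  condition (a).

  For the consequences, let \<open>v \<cdot> can = u\<close>.  If \<open>u\<close> is an epimorphism, then so is its last factor
  \<open>v\<close>.  If \<open>r \<cdot> u = id\<close>, put \<open>s = can \<cdot> r\<close>; then \<open>s \<cdot> v \<cdot> can = can \<cdot> r \<cdot> u = can\<close>.  The identity is
  the only endomorphism of \<open>Hom(L, -)\<close> that fixes \<open>can\<close>, because an arrow \<open>L \<rightarrow> L\<close> compatible with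
  all projections is the identity (\<open>endo_hom_ident\<close>); so \<open>s \<cdot> v = id\<close>.  If moreover \<open>u \<cdot> r = id\<close>,
  then \<open>v \<cdot> s = v \<cdot> can \<cdot> r = u \<cdot> r = id\<close>, so the same \<open>s\<close> is a two-sided inverse of \<open>v\<close>.
\<close>

section \<open>Set-valued functors elementwise\<close>

lemma set_cat_simps [simp]:
  "Obj (set_cat U) = U"
  "Hom (set_cat U) A B = A \<rightarrow>\<^sub>E B"
  "Ident (set_cat U) A = (\<lambda>x\<in>A. x)"
  "Comp (set_cat U) A B E g f = compose A g f"
  by (simp_all add: set_cat_def)

lemma op_cat_simps [simp]: "Obj (op_cat A) = Obj A" "Hom (op_cat A) X Y = Hom A Y X"
  by (simp_all add: op_cat_def)

lemma functor_cat_simps [simp]: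
  "Obj (functor_cat A B) = {F. is_functor A B F}"
  "Hom (functor_cat A B) = nat_trans A B"
  "Ident (functor_cat A B) F = (\<lambda>X\<in>Obj A. Ident B (FObj F X))"
  "Comp (functor_cat A B) F G H t s =
     (\<lambda>X\<in>Obj A. Comp B (FObj F X) (FObj G X) (FObj H X) (t X) (s X))"
  by (simp_all add: functor_cat_def)

lemma hom_func_simps [simp]:
  "FObj (hom_func C A) X = Hom C A X"
  "FMap (hom_func C A) X Y f = (\<lambda>g\<in>Hom C A X. Comp C A X Y f g)"
  by (simp_all add: hom_func_def)

lemma set_functor_map_mem:
  assumes "is_functor C (set_cat U) F" "X \<in> Obj C" "Y \<in> Obj C" "f \<in> Hom C X Y" "a \<in> FObj F X"
  shows "FMap F X Y f a \<in> FObj F Y"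
proof -
  have "FMap F X Y f \<in> FObj F X \<rightarrow>\<^sub>E FObj F Y"
    using assms(1-4) by (simp add: is_functor_def)
  then show ?thesis using assms(5) by (rule PiE_mem)
qed

lemma set_functor_map_ident:
  assumes "is_functor C (set_cat U) F" "X \<in> Obj C" "a \<in> FObj F X"
  shows "FMap F X X (Ident C X) a = a"
  using assms by (simp add: is_functor_def)

lemma set_functor_map_comp:
  assumes "is_functor C (set_cat U) F" "X \<in> Obj C" "Y \<in> Obj C" "Z \<in> Obj C"
    and "f \<in> Hom C X Y" "g \<in> Hom C Y Z" "a \<in> FObj F X"
  shows "FMap F X Z (Comp C X Y Z g f) a = FMap F Y Z g (FMap F X Y f a)"
  using assms by (simp add: is_functor_def compose_def)

lemma compose_eq_iff:
  "compose A g f = compose A g' f' \<longleftrightarrow> (\<forall>a\<in>A. g (f a) = g' (f' a))"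
  by (auto simp: compose_def restrict_def fun_eq_iff)

lemma nat_trans_set_iff:
  "t \<in> nat_trans C (set_cat U) F G \<longleftrightarrow>
     t \<in> extensional (Obj C) \<and>
     (\<forall>X\<in>Obj C. t X \<in> FObj F X \<rightarrow>\<^sub>E FObj G X) \<and>
     (\<forall>X\<in>Obj C. \<forall>Y\<in>Obj C. \<forall>f\<in>Hom C X Y. \<forall>a\<in>FObj F X.
        t Y (FMap F X Y f a) = FMap G X Y f (t X a))"
  by (auto simp: nat_trans_def compose_eq_iff PiE_iff)

lemma nat_trans_setI:
  assumes "t \<in> extensional (Obj C)"
    and "\<And>X. X \<in> Obj C \<Longrightarrow> t X \<in> FObj F X \<rightarrow>\<^sub>E FObj G X"
    and "\<And>X Y f a. \<lbrakk>X \<in> Obj C; Y \<in> Obj C; f \<in> Hom C X Y; a \<in> FObj F X\<rbrakk> \<Longrightarrow>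
           t Y (FMap F X Y f a) = FMap G X Y f (t X a)"
  shows "t \<in> nat_trans C (set_cat U) F G"
  using assms by (simp add: nat_trans_set_iff)

lemma nat_trans_set_component:
  assumes "t \<in> nat_trans C (set_cat U) F G" "X \<in> Obj C"
  shows "t X \<in> FObj F X \<rightarrow>\<^sub>E FObj G X"
  using assms by (simp add: nat_trans_set_iff)

lemma nat_trans_set_mem:
  assumes "t \<in> nat_trans C (set_cat U) F G" "X \<in> Obj C" "a \<in> FObj F X"
  shows "t X a \<in> FObj G X"
  using nat_trans_set_component[OF assms(1,2)] assms(3) by blast

lemma nat_trans_set_naturality:
  assumes "t \<in> nat_trans C (set_cat U) F G"
    and "X \<in> Obj C" "Y \<in> Obj C" "f \<in> Hom C X Y" "a \<in> FObj F X"
  shows "t Y (FMap F X Y f a) = FMap G X Y f (t X a)"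
  using assms by (simp add: nat_trans_set_iff)

lemma nat_trans_set_eqI:
  assumes t: "t \<in> nat_trans C (set_cat U) F G" and s: "s \<in> nat_trans C (set_cat U) F G"
    and eq: "\<And>X a. \<lbrakk>X \<in> Obj C; a \<in> FObj F X\<rbrakk> \<Longrightarrow> t X a = s X a"
  shows "t = s"
proof (rule extensionalityI[of _ "Obj C"])
  fix X assume X: "X \<in> Obj C"
  show "t X = s X"
    using nat_trans_set_component[OF t X] nat_trans_set_component[OF s X] eq[OF X]
    by (rule PiE_ext)
qed (use t s in \<open>auto simp: nat_trans_set_iff\<close>)

lemma nat_trans_comp_apply [simp]:
  assumes "X \<in> Obj C" "a \<in> FObj F X"
  shows "Comp (functor_cat C (set_cat U)) F G H t s X a = t X (s X a)"
  using assms by (simp add: compose_def)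

lemma nat_trans_comp_mem:
  assumes s: "s \<in> nat_trans C (set_cat U) F G" and t: "t \<in> nat_trans C (set_cat U) G H"
    and F: "is_functor C (set_cat U) F"
  shows "Comp (functor_cat C (set_cat U)) F G H t s \<in> nat_trans C (set_cat U) F H"
proof (rule nat_trans_setI)
  fix X Y f a assume *: "X \<in> Obj C" "Y \<in> Obj C" "f \<in> Hom C X Y" "a \<in> FObj F X"
  then have "FMap F X Y f a \<in> FObj F Y"
    by (rule set_functor_map_mem[OF F])
  with * show "Comp (functor_cat C (set_cat U)) F G H t s Y (FMap F X Y f a) =
      FMap H X Y f (Comp (functor_cat C (set_cat U)) F G H t s X a)"
    using nat_trans_set_naturality[OF s *]
      nat_trans_set_naturality[OF t *(1-3) nat_trans_set_mem[OF s *(1,4)]]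
    by (simp del: functor_cat_simps)
qed (use nat_trans_set_mem[OF s] nat_trans_set_mem[OF t] in \<open>auto simp: compose_def\<close>)

lemma nat_trans_comp_assoc:
  assumes "r \<in> nat_trans C (set_cat U) E F"
  shows "Comp (functor_cat C (set_cat U)) E G H t (Comp (functor_cat C (set_cat U)) E F G s r) =
         Comp (functor_cat C (set_cat U)) E F H (Comp (functor_cat C (set_cat U)) F G H t s) r"
  using nat_trans_set_mem[OF assms]
  by (auto simp: fun_eq_iff restrict_def compose_def)

lemma nat_trans_comp_ident:
  assumes "t \<in> nat_trans C (set_cat U) F G"
  shows "Comp (functor_cat C (set_cat U)) F F G t (Ident (functor_cat C (set_cat U)) F) = t"
proof
  fix X
  show "Comp (functor_cat C (set_cat U)) F F G t (Ident (functor_cat C (set_cat U)) F) X = t X"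
  proof (cases "X \<in> Obj C")
    case True
    then have "t X \<in> extensional (FObj F X)"
      using nat_trans_set_component[OF assms] by (auto simp: PiE_iff)
    then show ?thesis
      using True by (auto simp: fun_eq_iff compose_def restrict_def extensional_def)
  next
    case False
    then show ?thesis
      using assms by (simp add: nat_trans_set_iff extensional_def)
  qed
qed

section \<open>Elements of limits and colimits of sets\<close>

text \<open>
  A matching family is a cone with vertex a one-point set.  It is an arbitrary function on the
  type of indices, so only its values on the objects of the shape carry information.
\<close>

definition matching_family ::
    "('j, 'k) cat \<Rightarrow> ('j, 'k, 'u set, 'u \<Rightarrow> 'u) func \<Rightarrow> ('j \<Rightarrow> 'u) \<Rightarrow> bool" where
  "matching_family J E x \<longleftrightarrow>
     (\<forall>j\<in>Obj J. x j \<in> FObj E j) \<and>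
     (\<forall>i\<in>Obj J. \<forall>j\<in>Obj J. \<forall>a\<in>Hom J i j. FMap E i j a (x i) = x j)"

lemma set_universe_singleton:
  assumes "set_universe U"
  shows "{e} \<in> U"
proof -
  obtain A where A: "A \<in> U" "infinite A"
    using assms by (auto simp: set_universe_def)
  have "(\<lambda>_. e) ` A \<in> U"
    using assms A by (auto simp: set_universe_def)
  moreover have "(\<lambda>_. e) ` A = {e}"
    using A by (auto simp: image_constant_conv)
  ultimately show ?thesis by simp
qed

text \<open>
  One-point cones suffice to detect limits of sets: a cone with an arbitrary vertex \<open>X\<close> is a family
  of matching families indexed by the elements of \<open>X\<close>, so the mediating map can be defined one
  element at a time.
\<close>

lemma is_limit_set_iff:
  fixes E :: "('j, 'k, 'u set, 'u \<Rightarrow> 'u) func"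
  assumes U: "set_universe U" and cone: "is_cone J (set_cat U) E M q"
  shows "is_limit J (set_cat U) E M q \<longleftrightarrow>
    (\<forall>x. matching_family J E x \<longrightarrow> (\<exists>!a. a \<in> M \<and> (\<forall>j\<in>Obj J. q j a = x j)))"
    (is "?lim \<longleftrightarrow> ?match")
proof
  assume lim: ?lim
  show ?match
  proof (intro allI impI)
    fix x assume x: "matching_family J E x"
    \<comment> \<open>The cone on \<open>{e}\<close> with legs \<open>e \<mapsto> x j\<close> turns elements into maps out of a singleton.\<close>
    define e :: 'u where "e = undefined"
    have "is_cone J (set_cat U) E {e} (\<lambda>j. \<lambda>_\<in>{e}. x j)"
      using x set_universe_singleton[OF U, of e]
      by (auto simp: is_cone_def matching_family_def compose_def restrict_def fun_eq_iff
            split: if_splits)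
    with lim have ex1: "\<exists>!h. h \<in> {e} \<rightarrow>\<^sub>E M \<and>
        (\<forall>j\<in>Obj J. compose {e} (q j) h = (\<lambda>_\<in>{e}. x j))"
      by (simp add: is_limit_def)
    have point: "(\<lambda>_\<in>{e}. a) \<in> {e} \<rightarrow>\<^sub>E M \<and>
        (\<forall>j\<in>Obj J. compose {e} (q j) (\<lambda>_\<in>{e}. a) = (\<lambda>_\<in>{e}. x j))"
      if "a \<in> M \<and> (\<forall>j\<in>Obj J. q j a = x j)" for a
      using that by (auto simp: compose_def restrict_def fun_eq_iff split: if_splits)
    from ex1 obtain h where h: "h \<in> {e} \<rightarrow>\<^sub>E M"
        "\<forall>j\<in>Obj J. compose {e} (q j) h = (\<lambda>_\<in>{e}. x j)"
      by blast
    show "\<exists>!a. a \<in> M \<and> (\<forall>j\<in>Obj J. q j a = x j)"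
    proof (rule ex1I[of _ "h e"])
      show "h e \<in> M \<and> (\<forall>j\<in>Obj J. q j (h e) = x j)"
      proof (intro conjI ballI)
        show "h e \<in> M" using PiE_mem[OF h(1)] by simp
        fix j assume "j \<in> Obj J"
        with h(2) have "compose {e} (q j) h e = (\<lambda>_\<in>{e}. x j) e" by simp
        then show "q j (h e) = x j" by (simp add: compose_def)
      qed
    next
      fix a assume "a \<in> M \<and> (\<forall>j\<in>Obj J. q j a = x j)"
      from point[OF this] ex1 h have "(\<lambda>_\<in>{e}. a) = h" by blast
      then have "(\<lambda>_\<in>{e}. a) e = h e" by simp
      then show "a = h e" by simp
    qed
  qed
next
  assume match: ?match
  have "\<exists>!h. h \<in> X \<rightarrow>\<^sub>E M \<and> (\<forall>j\<in>Obj J. compose X (q j) h = r j)"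
    if r: "is_cone J (set_cat U) E X r" for X r
  proof -
    have "matching_family J E (\<lambda>j. r j b)" if b: "b \<in> X" for b
    proof -
      have "FMap E i j a (r i b) = r j b" if "i \<in> Obj J" "j \<in> Obj J" "a \<in> Hom J i j" for i j a
      proof -
        have "compose X (FMap E i j a) (r i) = r j"
          using r that by (simp add: is_cone_def)
        then show ?thesis using b by (metis compose_eq)
      qed
      moreover have "r j b \<in> FObj E j" if "j \<in> Obj J" for j
        using r that b by (auto simp: is_cone_def)
      ultimately show ?thesis by (simp add: matching_family_def)
    qed
    with match have ex1: "\<exists>!a. a \<in> M \<and> (\<forall>j\<in>Obj J. q j a = r j b)" if "b \<in> X" for b
      using that by blast
    define h where "h = (\<lambda>b\<in>X. THE a. a \<in> M \<and> (\<forall>j\<in>Obj J. q j a = r j b))"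
    have h: "h b \<in> M \<and> (\<forall>j\<in>Obj J. q j (h b) = r j b)" if "b \<in> X" for b
      using theI'[OF ex1[OF that]] that by (simp add: h_def)
    have rext: "r j \<in> extensional X" if "j \<in> Obj J" for j
      using r that by (simp add: is_cone_def PiE_iff)
    have char: "compose X (q j) g = r j \<longleftrightarrow> (\<forall>b\<in>X. q j (g b) = r j b)" if "j \<in> Obj J" for g j
      using rext[OF that] by (auto simp: compose_def restrict_def fun_eq_iff extensional_def)
    show ?thesis
    proof (rule ex1I[of _ h])
      show "h \<in> X \<rightarrow>\<^sub>E M \<and> (\<forall>j\<in>Obj J. compose X (q j) h = r j)"
        using h by (auto simp: char h_def)
    next
      fix g assume g: "g \<in> X \<rightarrow>\<^sub>E M \<and> (\<forall>j\<in>Obj J. compose X (q j) g = r j)"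
      show "g = h"
      proof (rule PiE_ext[of _ X "\<lambda>_. M"])
        fix b assume b: "b \<in> X"
        have "g b \<in> M \<and> (\<forall>j\<in>Obj J. q j (g b) = r j b)"
          using g b by (auto simp: char)
        with ex1[OF b] h[OF b] show "g b = h b" by blast
      qed (use g h in \<open>auto simp: h_def\<close>)
    qed
  qed
  with cone show ?lim by (simp add: is_limit_def)
qed

lemma set_colimit_induced_map:
  assumes colim: "is_colimit J (set_cat U) E N n" and Y: "Y \<in> U"
    and q: "\<And>j. j \<in> Obj J \<Longrightarrow> q j \<in> FObj E j \<rightarrow>\<^sub>E Y"
    and nat: "\<And>i j a b. \<lbrakk>i \<in> Obj J; j \<in> Obj J; a \<in> Hom J i j; b \<in> FObj E i\<rbrakk> \<Longrightarrow>
                q j (FMap E i j a b) = q i b"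
  shows "\<exists>!h. h \<in> N \<rightarrow>\<^sub>E Y \<and> (\<forall>j\<in>Obj J. compose (FObj E j) h (n j) = q j)"
proof -
  have "is_cocone J (set_cat U) E Y q"
    unfolding is_cocone_def
  proof (intro conjI ballI)
    fix i j a assume *: "i \<in> Obj J" "j \<in> Obj J" "a \<in> Hom J i j"
    have "q i \<in> extensional (FObj E i)" using q[OF *(1)] by (simp add: PiE_iff)
    with nat[OF *]
    show "Comp (set_cat U) (FObj E i) (FObj E j) Y (q j) (FMap E i j a) = q i"
      by (auto simp: compose_def restrict_def fun_eq_iff extensional_def)
  qed (use Y q in auto)
  with colim show ?thesis by (simp add: is_colimit_def)
qed

text \<open>
  Colimits of sets are covered by their coprojections: the coprojections corestrict to the union
  \<open>R\<close> of their images, and the map into \<open>R\<close> which this cocone induces, regarded as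
  an endomap of the colimit, is the identity because it fixes the coprojections.
\<close>

lemma set_colimit_surj:
  assumes U: "set_universe U" and colim: "is_colimit J (set_cat U) E N n" and z: "z \<in> N"
  obtains j b where "j \<in> Obj J" "b \<in> FObj E j" "z = n j b"
proof -
  let ?R = "\<Union>j\<in>Obj J. n j ` FObj E j"
  have N: "N \<in> U" and n: "\<And>j. j \<in> Obj J \<Longrightarrow> n j \<in> FObj E j \<rightarrow>\<^sub>E N"
    and comp: "\<And>i j a. \<lbrakk>i \<in> Obj J; j \<in> Obj J; a \<in> Hom J i j\<rbrakk> \<Longrightarrow>
                 compose (FObj E i) (n j) (FMap E i j a) = n i"
    using colim by (auto simp: is_colimit_def is_cocone_def)
  have nat: "n j (FMap E i j a b) = n i b"
    if "i \<in> Obj J" "j \<in> Obj J" "a \<in> Hom J i j" "b \<in> FObj E i" for i j a b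
    using comp[OF that(1-3)] that(4) by (metis compose_eq)
  have "?R \<subseteq> N" using n by blast
  then have "?R \<in> U" using U N unfolding set_universe_def by blast
  moreover have "n j \<in> FObj E j \<rightarrow>\<^sub>E ?R" if "j \<in> Obj J" for j
    using n[OF that] that by (auto simp: PiE_iff)
  ultimately obtain h where h: "h \<in> N \<rightarrow>\<^sub>E ?R"
      "\<forall>j\<in>Obj J. compose (FObj E j) h (n j) = n j"
    using set_colimit_induced_map[OF colim, of ?R n] nat by blast
  have hN: "h \<in> N \<rightarrow>\<^sub>E N" using h(1) \<open>?R \<subseteq> N\<close> by (auto simp: PiE_iff)
  have "compose (FObj E j) (\<lambda>y\<in>N. y) (n j) = n j" if "j \<in> Obj J" for j
    using n[OF that] by (auto simp: compose_def restrict_def fun_eq_iff PiE_iff extensional_def)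
  moreover have "(\<lambda>y\<in>N. y) \<in> N \<rightarrow>\<^sub>E N" by simp
  ultimately have "h = (\<lambda>y\<in>N. y)"
    using set_colimit_induced_map[OF colim N n nat] h(2) hN by blast
  with PiE_mem[OF h(1) z] z have "z \<in> ?R" by simp
  then show thesis using that by blast
qed

section \<open>The pointwise colimit of representables\<close>

text \<open>
  The functor \<open>F\<close> is left out because some results below are also applied with \<open>Hom(L, -)\<close> in its
  place.
\<close>

locale limit_with_pointwise_colimit =
  fixes U :: "'u set set"
    and J :: "('j, 'k) cat"
    and C :: "('o, 'u) cat"
    and D :: "('j, 'k, 'o, 'u) func"
    and L :: 'o and p :: "'j \<Rightarrow> 'u"
    and K :: "'o \<Rightarrow> 'u set" and k :: "'o \<Rightarrow> 'j \<Rightarrow> 'u \<Rightarrow> 'u"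
  assumes universe: "set_universe U"
    and cat_C: "category C"
    and small: "locally_small U C"
    and functor_D: "is_functor J C D"
    and limit: "is_limit J C D L p"
    and colimits: "pointwise_colimits U J C D K k"
begin

abbreviation "colimD \<equiv> colim_hom_func U J C D K k"
abbreviation "homL \<equiv> hom_func C L"
abbreviation "canD \<equiv> can U J C D K k L p"
abbreviation "Trans \<equiv> nat_trans C (set_cat U)"
abbreviation "vcomp \<equiv> Comp (functor_cat C (set_cat U))"

lemma L_obj: "L \<in> Obj C"
  using limit by (simp add: is_limit_def is_cone_def)

lemma p_hom: "j \<in> Obj J \<Longrightarrow> p j \<in> Hom C L (FObj D j)"
  using limit by (simp add: is_limit_def is_cone_def)

lemma p_cone:
  "\<lbrakk>i \<in> Obj J; j \<in> Obj J; a \<in> Hom J i j\<rbrakk> \<Longrightarrow>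
     Comp C L (FObj D i) (FObj D j) (FMap D i j a) (p i) = p j"
  using limit by (simp add: is_limit_def is_cone_def)

lemma D_obj: "j \<in> Obj J \<Longrightarrow> FObj D j \<in> Obj C"
  using functor_D by (simp add: is_functor_def)

lemma D_hom:
  "\<lbrakk>i \<in> Obj J; j \<in> Obj J; a \<in> Hom J i j\<rbrakk> \<Longrightarrow>
     FMap D i j a \<in> Hom C (FObj D i) (FObj D j)"
  using functor_D by (simp add: is_functor_def)

lemma ident_hom: "X \<in> Obj C \<Longrightarrow> Ident C X \<in> Hom C X X"
  using cat_C by (simp add: category_def)

lemma comp_hom:
  "\<lbrakk>X \<in> Obj C; Y \<in> Obj C; Z \<in> Obj C; f \<in> Hom C X Y; g \<in> Hom C Y Z\<rbrakk> \<Longrightarrow>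
     Comp C X Y Z g f \<in> Hom C X Z"
  using cat_C by (simp add: category_def)

lemma comp_ident:
  "\<lbrakk>X \<in> Obj C; Y \<in> Obj C; f \<in> Hom C X Y\<rbrakk> \<Longrightarrow> Comp C X X Y f (Ident C X) = f"
  "\<lbrakk>X \<in> Obj C; Y \<in> Obj C; f \<in> Hom C X Y\<rbrakk> \<Longrightarrow> Comp C X Y Y (Ident C Y) f = f"
  using cat_C by (simp_all add: category_def)

lemma comp_assoc:
  "\<lbrakk>W \<in> Obj C; X \<in> Obj C; Y \<in> Obj C; Z \<in> Obj C;
    f \<in> Hom C W X; g \<in> Hom C X Y; h \<in> Hom C Y Z\<rbrakk> \<Longrightarrow>
     Comp C W Y Z h (Comp C W X Y g f) = Comp C W X Z (Comp C X Y Z h g) f"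
  using cat_C by (simp add: category_def)

lemma hom_diagram_simps:
  "FObj (hom_diagram C D X) j = Hom C (FObj D j) X"
  "FMap (hom_diagram C D X) j i a =
     (\<lambda>g\<in>Hom C (FObj D j) X. Comp C (FObj D i) (FObj D j) X g (FMap D i j a))"
  by (simp_all add: hom_diagram_def func_comp_def contra_hom_func_def op_func_def)

lemma colimit_at:
  "X \<in> Obj C \<Longrightarrow> is_colimit (op_cat J) (set_cat U) (hom_diagram C D X) (K X) (k X)"
  using colimits by (simp add: pointwise_colimits_def)

lemma K_small: "X \<in> Obj C \<Longrightarrow> K X \<in> U"
  using colimit_at by (auto simp: is_colimit_def is_cocone_def)

lemma k_map: "\<lbrakk>X \<in> Obj C; j \<in> Obj J\<rbrakk> \<Longrightarrow> k X j \<in> Hom C (FObj D j) X \<rightarrow>\<^sub>E K X"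
  using colimit_at[of X]
  by (simp add: is_colimit_def is_cocone_def hom_diagram_simps)

lemma k_mem: "\<lbrakk>X \<in> Obj C; j \<in> Obj J; g \<in> Hom C (FObj D j) X\<rbrakk> \<Longrightarrow> k X j g \<in> K X"
  using k_map by (rule PiE_mem)

lemma k_cocone:
  assumes "X \<in> Obj C" "i \<in> Obj J" "j \<in> Obj J" "a \<in> Hom J i j" "g \<in> Hom C (FObj D j) X"
  shows "k X i (Comp C (FObj D i) (FObj D j) X g (FMap D i j a)) = k X j g"
proof -
  have "compose (Hom C (FObj D j) X) (k X i) (FMap (hom_diagram C D X) j i a) = k X j"
    using colimit_at[of X] assms(1-4)
    by (simp add: is_colimit_def is_cocone_def hom_diagram_simps(1))
  then have "compose (Hom C (FObj D j) X) (k X i) (FMap (hom_diagram C D X) j i a) g = k X j g"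
    by simp
  with assms(5) show ?thesis by (simp add: compose_eq hom_diagram_simps(2))
qed

text \<open>
  Every element of the colimit at \<open>X\<close> is the class of an arrow \<open>g : D j \<rightarrow> X\<close>.  This reduces all
  identities about maps out of the colimit functor to identities of arrows in the category.
\<close>

lemma colim_elem:
  assumes "X \<in> Obj C" "z \<in> K X"
  obtains j g where "j \<in> Obj J" "g \<in> Hom C (FObj D j) X" "z = k X j g"
  using set_colimit_surj[OF universe colimit_at[OF assms(1)] assms(2)] that
  by (auto simp: hom_diagram_simps(1))

lemma colim_map_ext:
  assumes "X \<in> Obj C" "h \<in> K X \<rightarrow>\<^sub>E Y" "h' \<in> K X \<rightarrow>\<^sub>E Y"
    and eq: "\<And>j g. \<lbrakk>j \<in> Obj J; g \<in> Hom C (FObj D j) X\<rbrakk> \<Longrightarrow> h (k X j g) = h' (k X j g)"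
  shows "h = h'"
  using assms(2,3) by (rule PiE_ext) (metis colim_elem[OF assms(1)] eq)

lemma colim_induced_map:
  assumes X: "X \<in> Obj C" and Y: "Y \<in> U"
    and q: "\<And>j g. \<lbrakk>j \<in> Obj J; g \<in> Hom C (FObj D j) X\<rbrakk> \<Longrightarrow> q j g \<in> Y"
    and nat: "\<And>i j a g. \<lbrakk>i \<in> Obj J; j \<in> Obj J; a \<in> Hom J i j; g \<in> Hom C (FObj D j) X\<rbrakk> \<Longrightarrow>
           q i (Comp C (FObj D i) (FObj D j) X g (FMap D i j a)) = q j g"
  shows "\<exists>!h. h \<in> K X \<rightarrow>\<^sub>E Y \<and>
           (\<forall>j\<in>Obj J. \<forall>g\<in>Hom C (FObj D j) X. h (k X j g) = q j g)"
proof -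
  let ?q = "\<lambda>j. \<lambda>g\<in>Hom C (FObj D j) X. q j g"
  have "\<exists>!h. h \<in> K X \<rightarrow>\<^sub>E Y \<and>
      (\<forall>j\<in>Obj (op_cat J). compose (FObj (hom_diagram C D X) j) h (k X j) = ?q j)"
  proof (rule set_colimit_induced_map[OF colimit_at[OF X] Y])
    fix i j a b
    assume "i \<in> Obj (op_cat J)" "j \<in> Obj (op_cat J)" "a \<in> Hom (op_cat J) i j"
      "b \<in> FObj (hom_diagram C D X) i"
    then show "?q j (FMap (hom_diagram C D X) i j a b) = ?q i b"
      by (simp add: hom_diagram_simps nat comp_hom[OF D_obj D_obj X D_hom])
  qed (auto simp: hom_diagram_simps q)
  moreover have "compose (Hom C (FObj D j) X) h (k X j) = ?q j \<longleftrightarrow>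
      (\<forall>g\<in>Hom C (FObj D j) X. h (k X j g) = q j g)" for h j
    by (auto simp: compose_def restrict_def fun_eq_iff)
  ultimately show ?thesis by (simp add: hom_diagram_simps(1))
qed

text \<open>
  These two properties replace the definite description by which the arrow part of the colimit
  functor is defined.
\<close>

lemma colim_func_map:
  assumes X: "X \<in> Obj C" and Y: "Y \<in> Obj C" and f: "f \<in> Hom C X Y"
  shows "FMap colimD X Y f \<in> K X \<rightarrow>\<^sub>E K Y"
    and "\<And>j g. \<lbrakk>j \<in> Obj J; g \<in> Hom C (FObj D j) X\<rbrakk> \<Longrightarrow>
           FMap colimD X Y f (k X j g) = k Y j (Comp C (FObj D j) X Y f g)"
proof -
  have ex1: "\<exists>!h. h \<in> K X \<rightarrow>\<^sub>E K Y \<and>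
      (\<forall>j\<in>Obj J. \<forall>g\<in>Hom C (FObj D j) X.
         h (k X j g) = k Y j (Comp C (FObj D j) X Y f g))"
  proof (rule colim_induced_map[OF X K_small[OF Y]])
    fix i j a g
    assume *: "i \<in> Obj J" "j \<in> Obj J" "a \<in> Hom J i j" "g \<in> Hom C (FObj D j) X"
    have "k Y i (Comp C (FObj D i) X Y f (Comp C (FObj D i) (FObj D j) X g (FMap D i j a))) =
        k Y i (Comp C (FObj D i) (FObj D j) Y (Comp C (FObj D j) X Y f g) (FMap D i j a))"
      using comp_assoc[OF D_obj D_obj X Y D_hom _ f] * by simp
    also have "\<dots> = k Y j (Comp C (FObj D j) X Y f g)"
      using * by (intro k_cocone[OF Y] comp_hom[OF D_obj X Y _ f])
    finally show "k Y i (Comp C (FObj D i) X Y f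
          (Comp C (FObj D i) (FObj D j) X g (FMap D i j a))) =
        k Y j (Comp C (FObj D j) X Y f g)" .
  qed (intro k_mem[OF Y] comp_hom[OF D_obj X Y _ f])
  have "FMap colimD X Y f =
      (THE h. h \<in> K X \<rightarrow>\<^sub>E K Y \<and>
        (\<forall>j\<in>Obj J. \<forall>g\<in>Hom C (FObj D j) X.
           h (k X j g) = k Y j (Comp C (FObj D j) X Y f g)))"
    by (simp add: colim_hom_func_def compose_eq_iff)
  with theI'[OF ex1] show "FMap colimD X Y f \<in> K X \<rightarrow>\<^sub>E K Y"
    and "\<And>j g. \<lbrakk>j \<in> Obj J; g \<in> Hom C (FObj D j) X\<rbrakk> \<Longrightarrow>
           FMap colimD X Y f (k X j g) = k Y j (Comp C (FObj D j) X Y f g)"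
    by simp_all
qed

lemma colim_func_obj [simp]: "FObj colimD X = K X"
  by (simp add: colim_hom_func_def)

lemma colim_func_is_functor: "is_functor C (set_cat U) colimD"
  unfolding is_functor_def
proof (intro conjI ballI)
  fix X assume X: "X \<in> Obj C"
  show "FObj colimD X \<in> Obj (set_cat U)" using K_small X by simp
  have "FMap colimD X X (Ident C X) = (\<lambda>z\<in>K X. z)"
    by (rule colim_map_ext[OF X colim_func_map(1)[OF X X ident_hom[OF X]]])
      (use X in \<open>auto simp: colim_func_map(2)[OF X X ident_hom[OF X]] k_mem comp_ident D_obj\<close>)
  then show "FMap colimD X X (Ident C X) = Ident (set_cat U) (FObj colimD X)" by simp
next
  fix X Y f assume "X \<in> Obj C" "Y \<in> Obj C" "f \<in> Hom C X Y"
  then show "FMap colimD X Y f \<in> Hom (set_cat U) (FObj colimD X) (FObj colimD Y)"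
    using colim_func_map(1) by simp
next
  fix X Y Z f g
  assume *: "X \<in> Obj C" "Y \<in> Obj C" "Z \<in> Obj C" "f \<in> Hom C X Y" "g \<in> Hom C Y Z"
  note gf = comp_hom[OF *]
  have "FMap colimD X Z (Comp C X Y Z g f) = compose (K X) (FMap colimD Y Z g) (FMap colimD X Y f)"
  proof (rule colim_map_ext[OF *(1) colim_func_map(1)[OF *(1,3) gf]])
    show "compose (K X) (FMap colimD Y Z g) (FMap colimD X Y f) \<in> K X \<rightarrow>\<^sub>E K Z"
      using colim_func_map(1)[OF *(1,2,4)] colim_func_map(1)[OF *(2,3,5)]
      by (auto simp: compose_def)
  next
    fix j h assume "j \<in> Obj J" "h \<in> Hom C (FObj D j) X"
    then show "FMap colimD X Z (Comp C X Y Z g f) (k X j h) =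
        compose (K X) (FMap colimD Y Z g) (FMap colimD X Y f) (k X j h)"
      using * gf by (simp add: compose_eq k_mem colim_func_map(2) comp_hom D_obj comp_assoc)
  qed
  then show "FMap colimD X Z (Comp C X Y Z g f) =
      Comp (set_cat U) (FObj colimD X) (FObj colimD Y) (FObj colimD Z)
        (FMap colimD Y Z g) (FMap colimD X Y f)"
    by simp
qed

text \<open>
  As for the colimit functor, the description by the universal property is traded for the value on
  classes of arrows: the class of \<open>g : D j \<rightarrow> X\<close> is sent to \<open>g\<close> after \<open>p j\<close>.
\<close>

lemma can_component:
  assumes X: "X \<in> Obj C"
  shows "canD X \<in> K X \<rightarrow>\<^sub>E Hom C L X"
    and "\<And>j g. \<lbrakk>j \<in> Obj J; g \<in> Hom C (FObj D j) X\<rbrakk> \<Longrightarrow>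
           canD X (k X j g) = Comp C L (FObj D j) X g (p j)"
proof -
  have HU: "Hom C L X \<in> U" using small L_obj X by (simp add: locally_small_def)
  have ex1: "\<exists>!h. h \<in> K X \<rightarrow>\<^sub>E Hom C L X \<and>
      (\<forall>j\<in>Obj J. \<forall>g\<in>Hom C (FObj D j) X. h (k X j g) = Comp C L (FObj D j) X g (p j))"
  proof (rule colim_induced_map[OF X HU])
    fix i j a g
    assume *: "i \<in> Obj J" "j \<in> Obj J" "a \<in> Hom J i j" "g \<in> Hom C (FObj D j) X"
    show "Comp C L (FObj D i) X (Comp C (FObj D i) (FObj D j) X g (FMap D i j a)) (p i) =
        Comp C L (FObj D j) X g (p j)"
      using comp_assoc[OF L_obj D_obj D_obj X p_hom D_hom *(4)] * by (simp add: p_cone)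
  qed (intro comp_hom[OF L_obj D_obj X p_hom])
  have "canD X = (THE h. h \<in> K X \<rightarrow>\<^sub>E Hom C L X \<and>
      (\<forall>j\<in>Obj J. \<forall>g\<in>Hom C (FObj D j) X. h (k X j g) = Comp C L (FObj D j) X g (p j)))"
  proof -
    have "compose (Hom C (FObj D j) X) h (k X j) = FMap (contra_hom_func C X) (FObj D j) L (p j)
      \<longleftrightarrow> (\<forall>g\<in>Hom C (FObj D j) X. h (k X j g) = Comp C L (FObj D j) X g (p j))" for h j
      by (auto simp: contra_hom_func_def compose_def restrict_def fun_eq_iff)
    then show ?thesis using X by (simp add: can_def)
  qed
  with theI'[OF ex1] show "canD X \<in> K X \<rightarrow>\<^sub>E Hom C L X"
    and "\<And>j g. \<lbrakk>j \<in> Obj J; g \<in> Hom C (FObj D j) X\<rbrakk> \<Longrightarrow>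
           canD X (k X j g) = Comp C L (FObj D j) X g (p j)"
    by simp_all
qed

lemma can_nat_trans: "canD \<in> Trans colimD homL"
proof (rule nat_trans_setI)
  fix X Y f z assume *: "X \<in> Obj C" "Y \<in> Obj C" "f \<in> Hom C X Y" "z \<in> FObj colimD X"
  then obtain j g where "j \<in> Obj J" "g \<in> Hom C (FObj D j) X" "z = k X j g"
    using colim_elem[OF *(1), of z] by auto
  with * show "canD Y (FMap colimD X Y f z) = FMap homL X Y f (canD X z)"
    by (simp add: colim_func_map(2) can_component(2) comp_hom D_obj L_obj p_hom comp_assoc)
qed (use can_component(1) in \<open>auto simp: can_def\<close>)

section \<open>Natural transformations as elements and as matching families\<close>

lemma hom_func_is_functor: "is_functor C (set_cat U) homL"
  using small L_obj
  by (auto simp: is_functor_def locally_small_def compose_def restrict_def fun_eq_iff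
      comp_hom ident_hom comp_ident comp_assoc)

definition yoneda :: "('o, 'u, 'u set, 'u \<Rightarrow> 'u) func \<Rightarrow> 'u \<Rightarrow> 'o \<Rightarrow> 'u \<Rightarrow> 'u" where
  "yoneda F a = (\<lambda>X\<in>Obj C. \<lambda>g\<in>Hom C L X. FMap F L X g a)"

lemma yoneda_nat_trans:
  assumes F: "is_functor C (set_cat U) F" and a: "a \<in> FObj F L"
  shows "yoneda F a \<in> Trans homL F"
proof (rule nat_trans_setI)
  fix X Y f g assume *: "X \<in> Obj C" "Y \<in> Obj C" "f \<in> Hom C X Y" "g \<in> FObj homL X"
  then show "yoneda F a Y (FMap homL X Y f g) = FMap F X Y f (yoneda F a X g)"
    using set_functor_map_comp[OF F L_obj *(1,2) _ *(3) a]
    by (simp add: yoneda_def comp_hom L_obj)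
qed (use set_functor_map_mem[OF F L_obj _ _ a] in \<open>auto simp: yoneda_def\<close>)

lemma yoneda_at_ident:
  assumes "is_functor C (set_cat U) F" "a \<in> FObj F L"
  shows "yoneda F a L (Ident C L) = a"
  using assms by (simp add: yoneda_def L_obj ident_hom set_functor_map_ident)

text \<open>
  The Yoneda lemma: naturality with respect to \<open>g : L \<rightarrow> X\<close>, applied to the identity of \<open>L\<close>.
\<close>

lemma nat_trans_hom_apply:
  assumes v: "v \<in> Trans homL F" and X: "X \<in> Obj C" and g: "g \<in> Hom C L X"
  shows "v X g = FMap F L X g (v L (Ident C L))"
  using nat_trans_set_naturality[OF v L_obj X g, of "Ident C L"] g X
  by (simp add: ident_hom L_obj comp_ident)

lemma nat_trans_hom_eqI:
  assumes "v \<in> Trans homL F" "w \<in> Trans homL F" "v L (Ident C L) = w L (Ident C L)"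
  shows "v = w"
  by (rule nat_trans_set_eqI[OF assms(1,2)])
    (simp add: assms(3) nat_trans_hom_apply[OF assms(1)] nat_trans_hom_apply[OF assms(2)])

text \<open>
  The restriction of \<open>u\<close> along the \<open>j\<close>-th coprojection is a natural transformation
  \<open>Hom(D j, -) \<rightarrow> F\<close>; the \<open>j\<close>-th member of the family is the element of \<open>F (D j)\<close> that corresponds
  to it under the Yoneda lemma.
\<close>

definition family_of ::
    "('o \<Rightarrow> 'u \<Rightarrow> 'u) \<Rightarrow> 'j \<Rightarrow> 'u" where
  "family_of u j = u (FObj D j) (k (FObj D j) j (Ident C (FObj D j)))"

lemma family_of_apply:
  assumes u: "u \<in> Trans colimD F" and X: "X \<in> Obj C" and j: "j \<in> Obj J"
    and g: "g \<in> Hom C (FObj D j) X"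
  shows "u X (k X j g) = FMap F (FObj D j) X g (family_of u j)"
proof -
  note Dj = D_obj[OF j]
  have "u X (FMap colimD (FObj D j) X g (k (FObj D j) j (Ident C (FObj D j)))) =
      FMap F (FObj D j) X g (family_of u j)"
    unfolding family_of_def
    using k_mem[OF Dj j ident_hom[OF Dj]]
    by (intro nat_trans_set_naturality[OF u Dj X g]) simp
  then show ?thesis
    by (simp add: colim_func_map(2)[OF Dj X g j ident_hom[OF Dj]] comp_ident(1)[OF Dj X g])
qed

text \<open>
  For \<open>a : i \<rightarrow> j\<close>, both the \<open>i\<close>-class of \<open>D a\<close> and the \<open>j\<close>-class of the identity of \<open>D j\<close> name the
  same element of the colimit at \<open>D j\<close>.
\<close>

lemma family_of_matching:
  assumes u: "u \<in> Trans colimD F"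
  shows "matching_family J (func_comp F D) (family_of u)"
proof -
  have "family_of u j \<in> FObj F (FObj D j)" if j: "j \<in> Obj J" for j
    unfolding family_of_def
    using nat_trans_set_mem[OF u D_obj[OF j]] k_mem[OF D_obj j ident_hom] j D_obj by simp
  moreover have "FMap F (FObj D i) (FObj D j) (FMap D i j a) (family_of u i) = family_of u j"
    if *: "i \<in> Obj J" "j \<in> Obj J" "a \<in> Hom J i j" for i j a
  proof -
    note Dij = D_obj[OF *(1)] D_obj[OF *(2)]
    have "FMap F (FObj D i) (FObj D j) (FMap D i j a) (family_of u i) =
        u (FObj D j) (k (FObj D j) i (FMap D i j a))"
      using family_of_apply[OF u Dij(2) *(1) D_hom[OF *]] by simp
    also have "k (FObj D j) i (FMap D i j a) = k (FObj D j) j (Ident C (FObj D j))"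
      using k_cocone[OF Dij(2) * ident_hom[OF Dij(2)]] comp_ident(2)[OF Dij D_hom[OF *]] by simp
    finally show ?thesis by (simp add: family_of_def)
  qed
  ultimately show ?thesis by (simp add: matching_family_def func_comp_def)
qed

text \<open>
  A matching family \<open>x\<close> gives the cocone \<open>g \<mapsto> F g (x j)\<close> on the arrows \<open>g : D j \<rightarrow> X\<close>; the induced
  maps out of the colimits are natural in \<open>X\<close>.
\<close>

lemma family_of_surj:
  assumes F: "is_functor C (set_cat U) F" and x: "matching_family J (func_comp F D) x"
  shows "\<exists>u\<in>Trans colimD F. \<forall>j\<in>Obj J. family_of u j = x j"
proof -
  have xj: "x j \<in> FObj F (FObj D j)" if "j \<in> Obj J" for j
    using x that by (simp add: matching_family_def func_comp_def)
  have xm: "FMap F (FObj D i) (FObj D j) (FMap D i j a) (x i) = x j"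
    if "i \<in> Obj J" "j \<in> Obj J" "a \<in> Hom J i j" for i j a
    using x that by (simp add: matching_family_def func_comp_def)
  have "\<exists>h. h \<in> K X \<rightarrow>\<^sub>E FObj F X \<and>
      (\<forall>j\<in>Obj J. \<forall>g\<in>Hom C (FObj D j) X. h (k X j g) = FMap F (FObj D j) X g (x j))"
    if X: "X \<in> Obj C" for X
  proof (rule ex1_implies_ex[OF colim_induced_map[OF X]])
    show "FObj F X \<in> U" using F X by (simp add: is_functor_def)
  next
    fix i j a g
    assume *: "i \<in> Obj J" "j \<in> Obj J" "a \<in> Hom J i j" "g \<in> Hom C (FObj D j) X"
    show "FMap F (FObj D i) X (Comp C (FObj D i) (FObj D j) X g (FMap D i j a)) (x i) =
        FMap F (FObj D j) X g (x j)"
      using set_functor_map_comp[OF F D_obj D_obj X D_hom *(4) xj] * by (simp add: xm)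
  qed (intro set_functor_map_mem[OF F D_obj X _ xj])
  then obtain h where h: "\<And>X. X \<in> Obj C \<Longrightarrow> h X \<in> K X \<rightarrow>\<^sub>E FObj F X"
      "\<And>X j g. \<lbrakk>X \<in> Obj C; j \<in> Obj J; g \<in> Hom C (FObj D j) X\<rbrakk> \<Longrightarrow>
         h X (k X j g) = FMap F (FObj D j) X g (x j)"
    by metis
  define u where "u = restrict h (Obj C)"
  have "u \<in> Trans colimD F"
  proof (rule nat_trans_setI)
    fix X Y f z assume *: "X \<in> Obj C" "Y \<in> Obj C" "f \<in> Hom C X Y" "z \<in> FObj colimD X"
    then obtain j g where "j \<in> Obj J" "g \<in> Hom C (FObj D j) X" "z = k X j g"
      using colim_elem[OF *(1), of z] by auto
    with * show "u Y (FMap colimD X Y f z) = FMap F X Y f (u X z)"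
      by (simp add: u_def h colim_func_map(2) comp_hom D_obj xj set_functor_map_comp[OF F])
  qed (use h(1) in \<open>auto simp: u_def\<close>)
  moreover have "family_of u j = x j" if "j \<in> Obj J" for j
    using that by (simp add: family_of_def u_def h D_obj ident_hom xj set_functor_map_ident[OF F])
  ultimately show ?thesis by blast
qed

lemma nat_trans_colim_eqI:
  assumes "u \<in> Trans colimD F" "w \<in> Trans colimD F" "\<And>j. j \<in> Obj J \<Longrightarrow> family_of u j = family_of w j"
  shows "u = w"
proof (rule nat_trans_set_eqI[OF assms(1,2)])
  fix X z assume X: "X \<in> Obj C" and "z \<in> FObj colimD X"
  then obtain j g where "j \<in> Obj J" "g \<in> Hom C (FObj D j) X" "z = k X j g"
    using colim_elem[OF X, of z] by auto
  with X show "u X z = w X z"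
    by (simp add: family_of_apply[OF assms(1)] family_of_apply[OF assms(2)] assms(3))
qed

text \<open>
  The canonical morphism sends the class of the identity of \<open>D j\<close> to the projection \<open>p j\<close>, so the
  family of \<open>v \<cdot> can\<close> is the image of the Yoneda element of \<open>v\<close> under the cone \<open>F (p j)\<close>.
\<close>

lemma family_of_comp_can:
  assumes v: "v \<in> Trans homL F" and j: "j \<in> Obj J"
  shows "family_of (vcomp colimD homL F v canD) j = FMap F L (FObj D j) (p j) (v L (Ident C L))"
proof -
  note Dj = D_obj[OF j]
  have "family_of (vcomp colimD homL F v canD) j = v (FObj D j) (p j)"
    using can_component(2)[OF Dj j ident_hom[OF Dj]] comp_ident(2)[OF L_obj Dj p_hom[OF j]]
    by (simp add: family_of_def Dj compose_eq k_mem j ident_hom)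
  then show ?thesis by (simp add: nat_trans_hom_apply[OF v Dj p_hom[OF j]])
qed

lemma comp_can_eq_iff:
  assumes v: "v \<in> Trans homL F" and u: "u \<in> Trans colimD F"
  shows "vcomp colimD homL F v canD = u \<longleftrightarrow>
    (\<forall>j\<in>Obj J. FMap F L (FObj D j) (p j) (v L (Ident C L)) = family_of u j)"
  using family_of_comp_can[OF v]
    nat_trans_colim_eqI[OF nat_trans_comp_mem[OF can_nat_trans v colim_func_is_functor] u]
  by metis

text \<open>
  The proof passes through two reformulations: unique solvability of \<open>F (p j) a = x j\<close> for every
  matching family \<open>x\<close>, and the same for the families that come from natural transformations \<open>u\<close>.
\<close>

lemma preserves_limit_iff_unique_extension:
  assumes F: "is_functor C (set_cat U) F"
  shows "preserves_limit J (set_cat U) D L p F \<longleftrightarrow>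
    (\<forall>u\<in>Trans colimD F. \<exists>!v. v \<in> Trans homL F \<and> vcomp colimD homL F v canD = u)"
    (is "_ \<longleftrightarrow> ?ext")
proof -
  let ?q = "\<lambda>j. FMap F L (FObj D j) (p j)"
  have "is_cone J (set_cat U) (func_comp F D) (FObj F L) ?q"
    unfolding is_cone_def
  proof (intro conjI ballI)
    show "FObj F L \<in> Obj (set_cat U)"
      using F L_obj unfolding is_functor_def by blast
  next
    fix j assume "j \<in> Obj J"
    then show "?q j \<in> Hom (set_cat U) (FObj F L) (FObj (func_comp F D) j)"
      using F L_obj D_obj p_hom by (simp add: is_functor_def func_comp_def)
  next
    fix i j a assume *: "i \<in> Obj J" "j \<in> Obj J" "a \<in> Hom J i j"
    have "FMap F L (FObj D j) (Comp C L (FObj D i) (FObj D j) (FMap D i j a) (p i)) =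
        compose (FObj F L) (FMap F (FObj D i) (FObj D j) (FMap D i j a)) (?q i)"
      using F L_obj D_obj[OF *(1)] D_obj[OF *(2)] p_hom[OF *(1)] D_hom[OF *]
      by (simp add: is_functor_def)
    then show "Comp (set_cat U) (FObj F L) (FObj (func_comp F D) i) (FObj (func_comp F D) j)
        (FMap (func_comp F D) i j a) (?q i) = ?q j"
      by (simp add: func_comp_def p_cone[OF *])
  qed
  from is_limit_set_iff[OF universe this]
  have "preserves_limit J (set_cat U) D L p F \<longleftrightarrow>
      (\<forall>x. matching_family J (func_comp F D) x \<longrightarrow>
         (\<exists>!a. a \<in> FObj F L \<and> (\<forall>j\<in>Obj J. ?q j a = x j)))" (is "_ \<longleftrightarrow> ?match")
    by (simp add: preserves_limit_def)
  also have "?match \<longleftrightarrow>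
      (\<forall>u\<in>Trans colimD F. \<exists>!a. a \<in> FObj F L \<and> (\<forall>j\<in>Obj J. ?q j a = family_of u j))"
  proof
    assume ?match
    then show "\<forall>u\<in>Trans colimD F. \<exists>!a. a \<in> FObj F L \<and> (\<forall>j\<in>Obj J. ?q j a = family_of u j)"
      using family_of_matching by blast
  next
    assume R: "\<forall>u\<in>Trans colimD F. \<exists>!a. a \<in> FObj F L \<and> (\<forall>j\<in>Obj J. ?q j a = family_of u j)"
    show ?match
    proof (intro allI impI)
      fix x assume "matching_family J (func_comp F D) x"
      then obtain u where u: "u \<in> Trans colimD F" "\<forall>j\<in>Obj J. family_of u j = x j"
        using family_of_surj[OF F] by blast
      from R u(1) have "\<exists>!a. a \<in> FObj F L \<and> (\<forall>j\<in>Obj J. ?q j a = family_of u j)" by blast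
      with u(2) show "\<exists>!a. a \<in> FObj F L \<and> (\<forall>j\<in>Obj J. ?q j a = x j)" by simp
    qed
  qed
  also have "\<dots> \<longleftrightarrow> ?ext"
  proof (rule ball_cong[OF refl])
    fix u assume u: "u \<in> Trans colimD F"
    let ?A = "\<lambda>a. a \<in> FObj F L \<and> (\<forall>j\<in>Obj J. ?q j a = family_of u j)"
    let ?V = "\<lambda>v. v \<in> Trans homL F \<and> vcomp colimD homL F v canD = u"
    have AV: "?V (yoneda F a)" if "?A a" for a
    proof -
      have a: "a \<in> FObj F L" and "\<forall>j\<in>Obj J. ?q j a = family_of u j"
        using that by blast+
      with comp_can_eq_iff[OF yoneda_nat_trans[OF F a] u] yoneda_nat_trans[OF F a]
      show ?thesis by (simp only: yoneda_at_ident[OF F a])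
    qed
    have VA: "?A (v L (Ident C L))" if "?V v" for v
    proof -
      have v: "v \<in> Trans homL F" and "vcomp colimD homL F v canD = u"
        using that by blast+
      then have "\<forall>j\<in>Obj J. ?q j (v L (Ident C L)) = family_of u j"
        using comp_can_eq_iff[OF v u] by blast
      moreover have "v L (Ident C L) \<in> FObj F L"
        using nat_trans_set_mem[OF v L_obj] ident_hom[OF L_obj] by simp
      ultimately show ?thesis by blast
    qed
    show "(\<exists>!a. ?A a) \<longleftrightarrow> (\<exists>!v. ?V v)"
    proof
      assume "\<exists>!a. ?A a"
      then obtain a where a: "?A a" and a_unique: "\<And>a'. ?A a' \<Longrightarrow> a' = a" by blast
      show "\<exists>!v. ?V v"
      proof (rule ex1I)
        show "?V (yoneda F a)" by (rule AV[OF a])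
        fix v assume v: "?V v"
        show "v = yoneda F a"
        proof (rule nat_trans_hom_eqI)
          show "v \<in> Trans homL F" "yoneda F a \<in> Trans homL F" using v AV[OF a] by blast+
          show "v L (Ident C L) = yoneda F a L (Ident C L)"
            using a_unique[OF VA[OF v]] a yoneda_at_ident[OF F] by metis
        qed
      qed
    next
      assume "\<exists>!v. ?V v"
      then obtain v where v: "?V v" and v_unique: "\<And>v'. ?V v' \<Longrightarrow> v' = v" by blast
      show "\<exists>!a. ?A a"
      proof (rule ex1I)
        show "?A (v L (Ident C L))" by (rule VA[OF v])
        fix a assume a: "?A a"
        show "a = v L (Ident C L)"
          using v_unique[OF AV[OF a]] a yoneda_at_ident[OF F] by metis
      qed
    qed
  qed
  finally show ?thesis .
qed

section \<open>Extensions along the canonical morphism\<close>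

text \<open>
  By Yoneda an endomorphism of \<open>Hom(L, -)\<close> is precomposition with an arrow \<open>e : L \<rightarrow> L\<close>.  Fixing
  the canonical morphism means \<open>p j \<circ> e = p j\<close> for all \<open>j\<close>, and the limit property forces
  \<open>e = id\<close>.
\<close>

lemma endo_hom_ident:
  assumes w: "w \<in> Trans homL homL" and fix_can: "vcomp colimD homL homL w canD = canD"
  shows "w = Ident (functor_cat C (set_cat U)) homL"
proof (rule nat_trans_hom_eqI[OF w])
  let ?e = "w L (Ident C L)"
  have e: "?e \<in> Hom C L L"
    using nat_trans_set_mem[OF w L_obj] ident_hom[OF L_obj] by simp
  have "Comp C L L (FObj D j) (p j) ?e = p j" if j: "j \<in> Obj J" for j
  proof -
    note Dj = D_obj[OF j]
    have "Comp C L L (FObj D j) (p j) ?e = family_of canD j"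
      using comp_can_eq_iff[OF w can_nat_trans] fix_can e j by simp
    also have "\<dots> = p j"
      using can_component(2)[OF Dj j ident_hom[OF Dj]] comp_ident(2)[OF L_obj Dj p_hom[OF j]]
      by (simp add: family_of_def)
    finally show ?thesis .
  qed
  moreover have "\<exists>!h. h \<in> Hom C L L \<and> (\<forall>j\<in>Obj J. Comp C L L (FObj D j) (p j) h = p j)"
    using limit by (simp add: is_limit_def)
  ultimately have "?e = Ident C L"
    using e ident_hom[OF L_obj] comp_ident(1)[OF L_obj D_obj p_hom] by blast
  then show "?e = Ident (functor_cat C (set_cat U)) homL L (Ident C L)"
    by (simp add: L_obj ident_hom)
next
  show "Ident (functor_cat C (set_cat U)) homL \<in> Trans homL homL"
    by (rule nat_trans_setI) (auto simp: comp_hom L_obj)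
qed

lemma epimorphism_extension:
  assumes v: "v \<in> Trans homL F"
    and epi: "epimorphism (functor_cat C (set_cat U)) colimD F (vcomp colimD homL F v canD)"
  shows "epimorphism (functor_cat C (set_cat U)) homL F v"
  unfolding epimorphism_def
proof (intro conjI ballI impI)
  fix Z g h
  assume "Z \<in> Obj (functor_cat C (set_cat U))"
    and "g \<in> Hom (functor_cat C (set_cat U)) F Z" "h \<in> Hom (functor_cat C (set_cat U)) F Z"
    and "vcomp homL F Z g v = vcomp homL F Z h v"
  then show "g = h"
    using epi nat_trans_comp_assoc[OF can_nat_trans, of F Z g v]
      nat_trans_comp_assoc[OF can_nat_trans, of F Z h v]
    unfolding epimorphism_def by metis
qed (use v in simp)

text \<open>
  The retraction of \<open>v\<close> is \<open>can \<cdot> r\<close>: following it after \<open>v \<cdot> can = u\<close> gives \<open>can \<cdot> r \<cdot> u = can\<close>, so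
  \<open>can \<cdot> r \<cdot> v\<close> is an endomorphism of \<open>Hom(L, -)\<close> that fixes the canonical morphism.
\<close>

lemma retraction_extension:
  assumes v: "v \<in> Trans homL F" and r: "r \<in> Trans F colimD"
    and F: "is_functor C (set_cat U) F"
    and ru: "vcomp colimD F colimD r (vcomp colimD homL F v canD) =
             Ident (functor_cat C (set_cat U)) colimD"
  shows "vcomp homL F homL (vcomp F colimD homL canD r) v = Ident (functor_cat C (set_cat U)) homL"
proof (rule endo_hom_ident)
  show "vcomp homL F homL (vcomp F colimD homL canD r) v \<in> Trans homL homL"
    by (intro nat_trans_comp_mem[OF v] nat_trans_comp_mem[OF r can_nat_trans] F hom_func_is_functor)
  have "vcomp colimD homL homL (vcomp homL F homL (vcomp F colimD homL canD r) v) canD =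
      vcomp colimD F homL (vcomp F colimD homL canD r) (vcomp colimD homL F v canD)"
    by (rule nat_trans_comp_assoc[OF can_nat_trans, symmetric])
  also have "\<dots> = vcomp colimD colimD homL canD
      (vcomp colimD F colimD r (vcomp colimD homL F v canD))"
    by (rule nat_trans_comp_assoc[symmetric])
      (rule nat_trans_comp_mem[OF can_nat_trans v colim_func_is_functor])
  also have "\<dots> = canD"
    unfolding ru by (rule nat_trans_comp_ident[OF can_nat_trans])
  finally show "vcomp colimD homL homL (vcomp homL F homL (vcomp F colimD homL canD r) v) canD =
      canD" .
qed

end

theorem theorem1p27:
  fixes U :: "'u set set"
    and J :: "('j, 'k) cat"
    and C :: "('o, 'u) cat"
    and D :: "('j, 'k, 'o, 'u) func"
    and L :: 'o and p :: "'j \<Rightarrow> 'u"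
    and K :: "'o \<Rightarrow> 'u set" and k :: "'o \<Rightarrow> 'j \<Rightarrow> 'u \<Rightarrow> 'u"
    and F :: "('o, 'u, 'u set, 'u \<Rightarrow> 'u) func"
  assumes "set_universe U"
    and "category J"
    and "category C" and "locally_small U C"
    and "is_functor J C D"
    and "is_limit J C D L p"
    and "pointwise_colimits U J C D K k"
    and "is_functor C (set_cat U) F"
  shows
    "let CSet = functor_cat C (set_cat U);
         colimD = colim_hom_func U J C D K k;
         homL = hom_func C L;
         canD = can U J C D K k L p;
         a = preserves_limit J (set_cat U) D L p F;
         b = (\<forall>u\<in>Hom CSet colimD F.
                \<exists>!v. v \<in> Hom CSet homL F \<and> Comp CSet colimD homL F v canD = u)
     in (a \<longleftrightarrow> b) \<and>
        (b \<longrightarrow>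
          (\<forall>u\<in>Hom CSet colimD F. \<forall>v\<in>Hom CSet homL F.
             Comp CSet colimD homL F v canD = u \<longrightarrow>
               (epimorphism CSet colimD F u \<longrightarrow> epimorphism CSet homL F v) \<and>
               (split_monomorphism CSet colimD F u \<longrightarrow> split_monomorphism CSet homL F v) \<and>
               (isomorphism CSet colimD F u \<longrightarrow> isomorphism CSet homL F v)))"
proof -
  interpret limit_with_pointwise_colimit U J C D L p K k
    using assms by unfold_locales
  note F = \<open>is_functor C (set_cat U) F\<close>
  let ?CSet = "functor_cat C (set_cat U)"
  have "(epimorphism ?CSet colimD F u \<longrightarrow> epimorphism ?CSet homL F v) \<and>
      (split_monomorphism ?CSet colimD F u \<longrightarrow> split_monomorphism ?CSet homL F v) \<and>
      (isomorphism ?CSet colimD F u \<longrightarrow> isomorphism ?CSet homL F v)"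
    if v: "v \<in> Trans homL F" and vu: "vcomp colimD homL F v canD = u" for u v
  proof (intro conjI impI)
    show "epimorphism ?CSet homL F v" if "epimorphism ?CSet colimD F u"
      using epimorphism_extension[OF v] that vu by blast
    show "split_monomorphism ?CSet homL F v" if u: "split_monomorphism ?CSet colimD F u"
    proof -
      obtain r where r: "r \<in> Trans F colimD" "vcomp colimD F colimD r u = Ident ?CSet colimD"
        using u unfolding split_monomorphism_def functor_cat_simps(2) by blast
      have "vcomp homL F homL (vcomp F colimD homL canD r) v = Ident ?CSet homL"
        by (rule retraction_extension[OF v r(1) F]) (simp only: vu r(2))
      with v nat_trans_comp_mem[OF r(1) can_nat_trans F] show ?thesis
        unfolding split_monomorphism_def functor_cat_simps(2) by blast
    qed
    show "isomorphism ?CSet homL F v" if u: "isomorphism ?CSet colimD F u"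
    proof -
      obtain r where r: "r \<in> Trans F colimD" "vcomp colimD F colimD r u = Ident ?CSet colimD"
          "vcomp F colimD F u r = Ident ?CSet F"
        using u unfolding isomorphism_def functor_cat_simps(2) by blast
      \<comment> \<open>The retraction that splits \<open>v\<close> is also a section, because \<open>v \<cdot> can \<cdot> r = u \<cdot> r\<close>.\<close>
      let ?s = "vcomp F colimD homL canD r"
      have "vcomp homL F homL ?s v = Ident ?CSet homL"
        by (rule retraction_extension[OF v r(1) F]) (simp only: vu r(2))
      moreover have "vcomp F homL F v ?s = Ident ?CSet F"
        using nat_trans_comp_assoc[OF r(1), of homL F v canD] r(3) by (simp only: vu)
      ultimately show ?thesis
        using v nat_trans_comp_mem[OF r(1) can_nat_trans F]
        unfolding isomorphism_def functor_cat_simps(2) by blast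
    qed
  qed
  with preserves_limit_iff_unique_extension[OF F] show ?thesis
    unfolding Let_def functor_cat_simps(2) by blast
qed

end
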